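(* Let $n\ge1$ and let $d$ be a positive even integer. The Lebesgue-volume function $v:P[x]_d\to\mathbb{R}$, $$g\mapsto v(g):=\mathrm{vol}\bigl(\{x\in\mathbb{R}^n: g(x)\le 1\}\bigr),$$ viewed as a function of the vector of coefficients $(g_\alpha)_{|\alpha|=d}$ of $g(x)=\sum_{|\alpha|=d}g_\alpha x^\alpha$, is strictly convex and lower semi-continuous. In $\mathrm{int}(P[x]_d)$ its gradient and Hessian are given by $$\frac{\partial v(g)}{\partial g_\alpha}=\frac{-1}{\Gamma(1+n/d)}\int_{\mathbb{R}^n}x^\alpha\exp(-g(x))\,dx\qquad\text{for all }\alpha\in\mathbb{N}^n,\ |\alpha|=d,$$ $$\frac{\partial^2 v(g)}{\partial g_\alpha\,\partial g_\beta}=\frac{1}{\Gamma(1+n/d)}\int_{\mathbb{R}^n}x^{\alpha+\beta}\exp(-g(x))\,dx\qquad\text{for all }\alpha,\beta\in\mathbb{N}^n,\ |\alpha|=|\beta|=d.$$ Moreover, for $g\in P[x]_d$, $$\int_{\mathbb{R}^n}g(x)\exp(-g(x))\,dx=\frac{n}{d}\int_{\mathbb{R}^n}\exp(-g(x))\,dx.$$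
   Context: $H[x]_d$ is the vector space of real homogeneous polynomials of degree $d$ in $x=(x_1,\ldots,x_n)$ (including $0$), identified with $\mathbb{R}^{\binom{n+d-1}{d}}$ via coefficients in the monomial basis $(x^\alpha)_{|\alpha|=d}$, where $|\alpha|=\sum_i\alpha_i$. $P[x]_d\subset H[x]_d$ is the set of those $g\in H[x]_d$ whose sublevel set $\{x\in\mathbb{R}^n: g(x)\le 1\}$ has finite Lebesgue volume (it is a convex set). $\mathrm{int}(P[x]_d)$ is its interior in $H[x]_d$. $\Gamma$ is the Gamma function and $\mathrm{vol}$ is Lebesgue measure on $\mathbb{R}^n$. *)

theory Defs
  imports "HOL-Analysis.Analysis"
begin

text \<open>
  Exponents \<open>\<alpha> \<in> \<nat>\<^sup>n\<close> with \<open>|\<alpha>| = d\<close>, where \<open>n = CARD('n)\<close> and \<open>d = CARD('d)\<close>; the type \<open>'d\<close> serves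
  only to encode the positive integer \<open>d\<close>.  With these exponents as a finite index type, \<open>H[x]\<^sub>d\<close>,
  identified with its space of coefficient vectors, becomes an ordinary Euclidean space.
\<close>

typedef (overloaded) ('n, 'd) multi_index =
    "{a :: 'n::finite \<Rightarrow> nat. (\<Sum>i\<in>UNIV. a i) = CARD('d::finite)}"
  morphisms expo Abs_multi_index
proof
  show "(\<lambda>i. if i = undefined then CARD('d) else 0) \<in> {a :: 'n \<Rightarrow> nat. (\<Sum>i\<in>UNIV. a i) = CARD('d)}"
    by simp
qed

instance multi_index :: (finite, finite) finite
proof
  let ?A = "{a :: 'a \<Rightarrow> nat. (\<Sum>i\<in>UNIV. a i) = CARD('b)}"
  have "a i \<le> CARD('b)" if "a \<in> ?A" for a i
    using that member_le_sum[of i UNIV a] by auto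
  then have "?A \<subseteq> (UNIV :: 'a set) \<rightarrow>\<^sub>E {..CARD('b)}"
    by auto
  then have "finite ?A"
    by (rule finite_subset) (simp add: finite_PiE)
  moreover have "(UNIV :: ('a, 'b) multi_index set) = Abs_multi_index ` ?A"
    by (rule type_definition.univ[OF type_definition_multi_index])
  ultimately show "finite (UNIV :: ('a, 'b) multi_index set)"
    by (metis finite_imageI)
qed

type_synonym ('n, 'd) form = "(real, ('n, 'd) multi_index) vec"

definition monomial :: "('n::finite \<Rightarrow> nat) \<Rightarrow> real ^ 'n \<Rightarrow> real" where
  "monomial a x = (\<Prod>i\<in>UNIV. (x $ i) ^ a i)"

definition eval_form :: "('n::finite, 'd::finite) form \<Rightarrow> real ^ 'n \<Rightarrow> real" where
  "eval_form g x = (\<Sum>\<alpha>\<in>UNIV. g $ \<alpha> * monomial (expo \<alpha>) x)"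

definition sublevel :: "('n::finite, 'd::finite) form \<Rightarrow> (real ^ 'n) set" where
  "sublevel g = {x. eval_form g x \<le> 1}"

definition finite_volume_forms :: "('n::finite, 'd::finite) form set" where
  "finite_volume_forms = {g. emeasure lborel (sublevel g) < \<infinity>}"

text \<open>Outside \<^const>\<open>finite_volume_forms\<close> the following takes the junk value \<open>0\<close>.\<close>

definition vol :: "('n::finite, 'd::finite) form \<Rightarrow> real" where
  "vol g = measure lborel (sublevel g)"

definition strictly_convex_on :: "'a::real_vector set \<Rightarrow> ('a \<Rightarrow> real) \<Rightarrow> bool" where
  "strictly_convex_on S f \<longleftrightarrow> convex S \<and>
    (\<forall>x\<in>S. \<forall>y\<in>S. \<forall>u>0. \<forall>v>0. x \<noteq> y \<longrightarrow> u + v = 1 \<longrightarrow>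
      f (u *\<^sub>R x + v *\<^sub>R y) < u * f x + v * f y)"

definition lower_semicontinuous_on :: "'a::topological_space set \<Rightarrow> ('a \<Rightarrow> real) \<Rightarrow> bool" where
  "lower_semicontinuous_on S f \<longleftrightarrow>
    (\<forall>x\<in>S. \<forall>c<f x. eventually (\<lambda>y. c < f y) (at x within S))"

text \<open>
  The Hessian is the Frechet derivative of the gradient map; the entry \<open>A $ i $ j\<close> is the partial
  derivative in direction \<open>j\<close> of the \<open>i\<close>-th component of the gradient.
\<close>

definition has_hessian :: "(real ^ 'm \<Rightarrow> real) \<Rightarrow> real ^ 'm ^ 'm \<Rightarrow> real ^ 'm \<Rightarrow> bool" where
  "has_hessian f A x \<longleftrightarrow>
    (\<exists>G. (\<forall>\<^sub>F y in nhds x. GDERIV f y :> G y) \<and> (G has_derivative (\<lambda>h. A *v h)) (at x))"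

end

theory Submission
  imports Defs "HOL-Computational_Algebra.Polynomial"
begin

text \<open>
  Write \<open>n = CARD('n)\<close> and \<open>d = CARD('d)\<close>. Everything rests on trading the volume for a smooth
  integral. A form \<open>g\<close> with finite sublevel volume is nonnegative, because a nonempty cone
  \<open>{x. g x < 0}\<close> is open and invariant under dilation, hence of infinite volume
  (\<open>finite_volume_imp_nonneg\<close>). Homogeneity gives \<open>vol {g \<le> t} = t powr (n / d) * vol {g \<le> 1}\<close> for
  \<open>t > 0\<close>. Whenever \<open>\<phi> s\<close> is the integral of a nonnegative weight \<open>w\<close> over \<open>{s..}\<close>, Tonelli's
  theorem thus turns \<open>\<integral> \<phi> (g x) dx\<close> into \<open>vol g * \<integral> t powr (n / d) * w t dt\<close>
  (\<open>nn_integral_layer_cake\<close>). The weight \<open>exp (- t)\<close> gives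
  \<open>\<integral> exp (- g) = Gamma (1 + n / d) * vol g\<close>. The weight \<open>t * exp (- t)\<close>, whose tail integral is
  \<open>(1 + s) * exp (- s)\<close>, gives \<open>\<integral> (1 + g) * exp (- g) = (1 + n / d) * \<integral> exp (- g)\<close>, which after
  subtraction of \<open>\<integral> exp (- g)\<close> is the last claim of the theorem.

  The properties of the volume are now those of \<open>g \<mapsto> \<integral> exp (- g)\<close>. It is strictly convex because
  \<open>exp\<close> is, and because distinct coefficient vectors define distinct functions (\<open>form_eq_0\<close>), so
  that the pointwise inequality is strict on a nonempty open set. It is lower semicontinuous by
  Fatou's lemma.

  For the derivatives, let \<open>q\<close> be the form \<open>\<Sum>i. x\<^sub>i ^ d\<close>, which for even \<open>d\<close> is nonnegative and
  dominates the modulus of every monomial of degree \<open>d\<close>. At an interior point \<open>g\<close> the form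
  \<open>g - \<epsilon> q\<close> still has finite volume for small \<open>\<epsilon>\<close> and is therefore nonnegative, so that \<open>\<epsilon> q \<le> g\<close>
  (\<open>interior_imp_coercive\<close>). With \<open>N\<close> the number of monomials, a perturbation \<open>h\<close> satisfies
  \<open>\<bar>h\<bar> \<le> N * norm h * q\<close>, so for small \<open>h\<close> the error of \<open>exp (- g - h)\<close> to first order is at most
  a constant times \<open>(norm h)\<^sup>2 * q\<^sup>2 * exp (- (\<epsilon> / 2) * q)\<close>, which remains integrable after
  multiplication by a power of \<open>q\<close>. Hence moments \<open>\<integral> m * exp (- g)\<close> with \<open>\<bar>m\<bar> \<le> q ^ k\<close> may be
  differentiated under the integral (\<open>moment_has_derivative\<close>). Applied to the weight \<open>1\<close> this
  yields the gradient, and applied to a monomial it yields a row of the Hessian.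
\<close>

section \<open>Forms as functions\<close>

lemma eval_form_add: "eval_form (g + h) x = eval_form g x + eval_form h x"
  by (simp add: eval_form_def algebra_simps sum.distrib)

lemma eval_form_diff: "eval_form (g - h) x = eval_form g x - eval_form h x"
  by (simp add: eval_form_def algebra_simps sum_subtractf)

lemma eval_form_scaleR: "eval_form (c *\<^sub>R g) x = c * eval_form g x"
  by (simp add: eval_form_def algebra_simps sum_distrib_left)

lemma eval_form_sum: "eval_form (\<Sum>i\<in>A. g i) x = (\<Sum>i\<in>A. eval_form (g i) x)"
  by (induction A rule: infinite_finite_induct) (simp_all add: eval_form_add, simp_all add: eval_form_def)

lemma eval_form_axis: "eval_form (axis \<alpha> c) x = c * monomial (expo \<alpha>) x"
  by (simp add: eval_form_def axis_def if_distrib[of "\<lambda>t. t * _"] cong: if_cong)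

lemma continuous_on_monomial [continuous_intros]: "continuous_on S (monomial a)"
  unfolding monomial_def by (intro continuous_intros)

lemma borel_measurable_monomial [measurable]: "monomial a \<in> borel_measurable borel"
  by (rule borel_measurable_continuous_onI) (rule continuous_on_monomial)

lemma continuous_on_eval_form: "continuous_on S (eval_form g)"
  unfolding eval_form_def by (intro continuous_intros)

lemma continuous_on_coeffs_eval_form: "continuous_on S (\<lambda>g. eval_form g x)"
  unfolding eval_form_def by (intro continuous_intros)

lemma borel_measurable_eval_form [measurable]: "eval_form g \<in> borel_measurable borel"
  by (rule borel_measurable_continuous_onI) (rule continuous_on_eval_form)

lemma sum_expo: "(\<Sum>i\<in>UNIV. expo (\<alpha> :: ('n::finite, 'd::finite) multi_index) i) = CARD('d)"
  using expo[of \<alpha>] by simp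

lemma monomial_add: "monomial (\<lambda>i. a i + b i) x = monomial a x * monomial b x"
  by (simp add: monomial_def power_add prod.distrib)

lemma eval_form_homogeneous:
  fixes g :: "('n::finite, 'd::finite) form"
  shows "eval_form g (t *\<^sub>R x) = t ^ CARD('d) * eval_form g x"
proof -
  have "monomial (expo \<alpha>) (t *\<^sub>R x) = t ^ CARD('d) * monomial (expo \<alpha>) x"
    for \<alpha> :: "('n, 'd) multi_index"
    by (simp add: monomial_def power_mult_distrib prod.distrib power_sum[symmetric] sum_expo)
  then show ?thesis
    by (simp add: eval_form_def sum_distrib_left mult.left_commute)
qed

text \<open>
  Reduction modulo \<open>b\<close> isolates the lowest digit; cancelling it and a factor \<open>b\<close> leaves one digit fewer.
\<close>

lemma digits_unique:
  fixes a c :: "nat \<Rightarrow> nat"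
  assumes "(\<Sum>k<n. a k * b ^ k) = (\<Sum>k<n. c k * b ^ k)"
    and "\<And>k. a k < b" "\<And>k. c k < b" "k < n"
  shows "a k = c k"
  using assms
proof (induction n arbitrary: a c k)
  case (Suc n)
  have split: "(\<Sum>k<Suc n. e k * b ^ k) = e 0 + b * (\<Sum>k<n. e (Suc k) * b ^ k)" for e :: "nat \<Rightarrow> nat"
    by (simp only: sum.lessThan_Suc_shift) (simp add: sum_distrib_left mult_ac)
  have eq: "a 0 + b * (\<Sum>k<n. a (Suc k) * b ^ k) = c 0 + b * (\<Sum>k<n. c (Suc k) * b ^ k)"
    using Suc.prems(1) by (simp only: split)
  have "a 0 = c 0"
    using arg_cong[OF eq, of "\<lambda>t. t mod b"] Suc.prems(2)[of 0] Suc.prems(3)[of 0] by simp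
  moreover have "(\<Sum>k<n. a (Suc k) * b ^ k) = (\<Sum>k<n. c (Suc k) * b ^ k)"
    using eq \<open>a 0 = c 0\<close> Suc.prems(2)[of 0] by simp
  then have "\<And>k. k < n \<Longrightarrow> a (Suc k) = c (Suc k)"
    using Suc.IH[of "\<lambda>k. a (Suc k)" "\<lambda>k. c (Suc k)"] Suc.prems by blast
  ultimately show ?case
    using Suc.prems(4) by (cases k) auto
qed simp

text \<open>
  Kronecker's substitution: with \<open>b = d + 1\<close> and the coordinates numbered by \<open>k < n\<close>, put
  \<open>t ^ (b ^ k)\<close> for the \<open>k\<close>-th coordinate.  Each exponent of a monomial is at most \<open>d\<close>, so distinct
  monomials become distinct powers of \<open>t\<close> by uniqueness of base-\<open>b\<close> digits.  The result is a
  univariate polynomial with the same coefficients, and it vanishes identically.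
\<close>

lemma form_eq_0:
  fixes g :: "('n::finite, 'd::finite) form"
  assumes zero: "\<And>x. eval_form g x = 0"
  shows "g = 0"
proof -
  obtain e where e: "bij_betw e {0..<CARD('n)} (UNIV :: 'n set)"
    using ex_bij_betw_nat_finite[OF finite[of "UNIV :: 'n set"]] by blast
  define b where "b = Suc CARD('d)"
  define w where "w i = b ^ the_inv_into {0..<CARD('n)} e i" for i
  define K where "K \<alpha> = (\<Sum>i\<in>UNIV. expo \<alpha> i * w i)" for \<alpha> :: "('n, 'd) multi_index"
  have K: "K \<alpha> = (\<Sum>k<CARD('n). expo \<alpha> (e k) * b ^ k)" for \<alpha>
  proof -
    have "K \<alpha> = (\<Sum>k\<in>{0..<CARD('n)}. expo \<alpha> (e k) * w (e k))"
      unfolding K_def by (rule sum.reindex_bij_betw[OF e, symmetric])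
    also have "\<dots> = (\<Sum>k<CARD('n). expo \<alpha> (e k) * b ^ k)"
      using e by (intro sum.cong) (auto simp: w_def bij_betw_def the_inv_into_f_f)
    finally show ?thesis .
  qed
  have digit: "expo \<alpha> i < b" for \<alpha> :: "('n, 'd) multi_index" and i
    using member_le_sum[of i UNIV "expo \<alpha>"] sum_expo[of \<alpha>] by (simp add: b_def)
  have "inj K"
  proof (rule injI)
    fix \<alpha> \<beta> :: "('n, 'd) multi_index" assume "K \<alpha> = K \<beta>"
    have "expo \<alpha> i = expo \<beta> i" for i
    proof -
      obtain k where "k < CARD('n)" "i = e k"
        using e by (metis UNIV_I atLeastLessThan_iff bij_betw_def imageE)
      then show ?thesis
        using digits_unique[of "\<lambda>k. expo \<alpha> (e k)" b "CARD('n)" "\<lambda>k. expo \<beta> (e k)" k]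
          \<open>K \<alpha> = K \<beta>\<close> digit by (simp add: K)
    qed
    then show "\<alpha> = \<beta>"
      by (metis expo_inject ext)
  qed
  define P where "P = (\<Sum>\<alpha>\<in>UNIV. monom (g $ \<alpha>) (K \<alpha>))"
  have "poly P t = 0" for t
  proof -
    have "monomial (expo \<alpha>) (\<chi> i. t ^ w i) = t ^ K \<alpha>" for \<alpha> :: "('n, 'd) multi_index"
      by (simp add: monomial_def K_def power_sum power_mult[symmetric] mult.commute)
    then have "eval_form g (\<chi> i. t ^ w i) = poly P t"
      by (simp add: eval_form_def P_def poly_sum poly_monom)
    then show ?thesis by (simp add: zero)
  qed
  then have "P = 0"
    by (simp add: poly_all_0_iff_0[symmetric])
  have "g $ \<alpha> = 0" for \<alpha>
  proof -
    have "coeff P (K \<alpha>) = (\<Sum>\<beta>\<in>UNIV. if \<beta> = \<alpha> then g $ \<beta> else 0)"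
      using \<open>inj K\<close> by (auto simp: P_def coeff_sum coeff_monom inj_eq intro!: sum.cong)
    then show ?thesis using \<open>P = 0\<close> by simp
  qed
  then show ?thesis by (simp add: vec_eq_iff)
qed

definition pure_power :: "'n \<Rightarrow> ('n::finite, 'd::finite) multi_index" where
  "pure_power i = Abs_multi_index (\<lambda>j. if j = i then CARD('d) else 0)"

text \<open>
  The yardstick of growth: for even \<open>d\<close>, some multiple of it bounds every form of degree \<open>d\<close> from
  above, and some positive multiple of it bounds every interior finite-volume form from below.
\<close>

definition power_form :: "('n::finite, 'd::finite) form" where
  "power_form = (\<Sum>i\<in>UNIV. axis (pure_power i) 1)"

lemma eval_power_form:
  "eval_form (power_form :: ('n::finite, 'd::finite) form) x = (\<Sum>i\<in>UNIV. (x $ i) ^ CARD('d))"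
proof -
  have "monomial (expo (pure_power i :: ('n, 'd) multi_index)) x = (x $ i) ^ CARD('d)" for i
  proof -
    have "expo (pure_power i :: ('n, 'd) multi_index) = (\<lambda>j. if j = i then CARD('d) else 0)"
      unfolding pure_power_def by (rule Abs_multi_index_inverse) simp
    then show ?thesis
      by (simp add: monomial_def if_distrib[of "\<lambda>k. _ ^ k"] cong: if_cong)
  qed
  then show ?thesis
    by (simp add: power_form_def eval_form_sum eval_form_axis)
qed

lemma eval_power_form_nonneg:
  assumes "even CARD('d)"
  shows "0 \<le> eval_form (power_form :: ('n::finite, 'd::finite) form) x"
  using assms by (simp add: eval_power_form sum_nonneg zero_le_even_power)

text \<open>
  If \<open>j\<close> is the coordinate of largest modulus, the monomial is at most \<open>\<bar>x\<^sub>j\<bar> ^ d\<close>, which is one of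
  the summands of the power form when \<open>d\<close> is even.
\<close>

lemma abs_monomial_le_power_form:
  fixes \<alpha> :: "('n::finite, 'd::finite) multi_index"
  assumes "even CARD('d)"
  shows "\<bar>monomial (expo \<alpha>) x\<bar> \<le> eval_form (power_form :: ('n, 'd) form) x"
proof -
  obtain j where j: "\<bar>x $ i\<bar> \<le> \<bar>x $ j\<bar>" for i
    using Max_in[of "range (\<lambda>i. \<bar>x $ i\<bar>)"] Max_ge[of "range (\<lambda>i. \<bar>x $ i\<bar>)"] by fastforce
  have "\<bar>monomial (expo \<alpha>) x\<bar> = (\<Prod>i\<in>UNIV. \<bar>x $ i\<bar> ^ expo \<alpha> i)"
    by (simp add: monomial_def abs_prod power_abs)
  also have "\<dots> \<le> (\<Prod>i\<in>UNIV. \<bar>x $ j\<bar> ^ expo \<alpha> i)"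
    by (intro prod_mono conjI power_mono j) auto
  also have "\<dots> = (x $ j) ^ CARD('d)"
    using assms by (simp add: power_sum[symmetric] sum_expo power_even_abs)
  also have "\<dots> \<le> (\<Sum>i\<in>UNIV. (x $ i) ^ CARD('d))"
    using assms by (intro member_le_sum) (auto simp: zero_le_even_power)
  finally show ?thesis by (simp add: eval_power_form)
qed

lemma abs_eval_form_le:
  fixes h :: "('n::finite, 'd::finite) form"
  assumes "even CARD('d)"
  shows "\<bar>eval_form h x\<bar> \<le>
    CARD(('n, 'd) multi_index) * norm h * eval_form (power_form :: ('n, 'd) form) x"
proof -
  have "\<bar>eval_form h x\<bar> \<le> (\<Sum>\<alpha>\<in>UNIV. \<bar>h $ \<alpha>\<bar> * \<bar>monomial (expo \<alpha>) x\<bar>)"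
    unfolding eval_form_def by (rule order.trans[OF sum_abs]) (simp add: abs_mult)
  also have "\<dots> \<le> (\<Sum>\<alpha>\<in>(UNIV :: ('n, 'd) multi_index set).
      norm h * eval_form (power_form :: ('n, 'd) form) x)"
    using assms by (intro sum_mono mult_mono abs_monomial_le_power_form component_le_norm_cart) auto
  finally show ?thesis by simp
qed

section \<open>The volume as an integral of exp(-g)\<close>

lemma emeasure_lborel_dilate:
  fixes S :: "'a::euclidean_space set"
  assumes "0 < c" and [measurable]: "S \<in> sets borel"
  shows "emeasure lborel S = ennreal (c ^ DIM('a)) * emeasure lborel {x. c *\<^sub>R x \<in> S}"
proof -
  have "emeasure lborel S =
      emeasure (density (distr lborel borel (\<lambda>x. 0 + c *\<^sub>R x)) (\<lambda>_. ennreal (\<bar>c\<bar> ^ DIM('a)))) S"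
    using lborel_affine[of c "0 :: 'a"] assms(1) by simp
  also have "\<dots> = ennreal (c ^ DIM('a)) * emeasure lborel ((\<lambda>x. 0 + c *\<^sub>R x) -` S)"
    using assms by (subst emeasure_density_const) (simp_all add: emeasure_distr)
  finally show ?thesis by (simp add: vimage_def)
qed

text \<open>
  The dilation by \<open>t powr (1 / d)\<close> maps the sublevel set at \<open>1\<close> onto the one at \<open>t\<close>.
\<close>

lemma emeasure_sublevel_dilate:
  fixes g :: "('n::finite, 'd::finite) form"
  assumes "0 < t"
  shows "emeasure lborel {x. eval_form g x \<le> t} =
    ennreal (t powr (CARD('n) / CARD('d))) * emeasure lborel (sublevel g)"
proof -
  define c where "c = t powr (1 / CARD('d))"
  have "0 < c" using assms by (simp add: c_def)
  have "c ^ k = t powr (k / CARD('d))" for k :: nat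
    using \<open>0 < c\<close> assms by (simp add: c_def powr_realpow[symmetric] powr_powr)
  note pow = this this[of "CARD('d)"]
  have "{x. c *\<^sub>R x \<in> {x. eval_form g x \<le> t}} = sublevel g"
    using assms by (simp add: sublevel_def eval_form_homogeneous pow(2))
  then show ?thesis
    using emeasure_lborel_dilate[OF \<open>0 < c\<close>, of "{x. eval_form g x \<le> t}"] pow(1) by simp
qed

lemma emeasure_lborel_open_pos:
  fixes U :: "'a::euclidean_space set"
  assumes "open U" "U \<noteq> {}"
  shows "0 < emeasure lborel U"
proof (rule ccontr)
  assume "\<not> 0 < emeasure lborel U"
  then have "U \<in> null_sets lborel"
    using assms by (auto simp: null_sets_def)
  then have "negligible U"
    by (simp add: negligible_iff_null_sets null_sets_completionI)
  then show False using open_not_negligible assms by blast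
qed

text \<open>
  The open cone \<open>U = {x. g x < 0}\<close> lies in the sublevel set and satisfies \<open>2 U = U\<close>, so its volume
  \<open>r\<close> is finite and \<open>r = 2 ^ n * r\<close>.  Thus \<open>r = 0\<close>, which forces \<open>U\<close> to be empty.
\<close>

lemma finite_volume_imp_nonneg:
  fixes g :: "('n::finite, 'd::finite) form"
  assumes "g \<in> finite_volume_forms"
  shows "0 \<le> eval_form g x"
proof (rule ccontr)
  assume "\<not> 0 \<le> eval_form g x"
  define U where "U = {x. eval_form g x < 0}"
  have "open U"
    unfolding U_def by (intro open_Collect_less continuous_on_eval_form continuous_intros)
  have "U \<noteq> {}"
    using \<open>\<not> 0 \<le> eval_form g x\<close> by (auto simp: U_def not_le)
  have "emeasure lborel U \<le> emeasure lborel (sublevel g)"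
    by (rule emeasure_mono) (auto simp: U_def sublevel_def)
  then have fin: "emeasure lborel U < \<infinity>"
    using assms by (simp add: finite_volume_forms_def order.strict_trans1)
  have "{x. 2 *\<^sub>R x \<in> U} = U"
    by (simp add: U_def eval_form_homogeneous mult_less_0_iff)
  then have "emeasure lborel U = ennreal (2 ^ CARD('n)) * emeasure lborel U"
    using emeasure_lborel_dilate[of 2 U] \<open>open U\<close> by simp
  moreover obtain r where r: "emeasure lborel U = ennreal r" "0 \<le> r"
    using fin by (cases "emeasure lborel U") auto
  ultimately have "ennreal r = ennreal (2 ^ CARD('n) * r)"
    by (simp add: ennreal_mult)
  then have "r = 2 ^ CARD('n) * r"
    using r(2) by (subst (asm) ennreal_inj) auto
  moreover have "(2 :: real) ^ CARD('n) > 1"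
    by (rule one_less_power) auto
  ultimately have "r = 0" by simp
  then show False
    using r emeasure_lborel_open_pos[OF \<open>open U\<close> \<open>U \<noteq> {}\<close>] by simp
qed

text \<open>
  By Tonelli, integrate over \<open>x\<close> first: the inner integral is then the volume of \<open>{g \<le> t}\<close>, which is
  known from homogeneity for \<open>t > 0\<close> and is \<open>0\<close> for \<open>t < 0\<close> since \<open>g\<close> is nonnegative.
\<close>

lemma nn_integral_layer_cake:
  fixes g :: "('n::finite, 'd::finite) form" and w :: "real \<Rightarrow> ennreal"
  assumes g: "g \<in> finite_volume_forms" and [measurable]: "w \<in> borel_measurable borel"
  shows "(\<integral>\<^sup>+x. (\<integral>\<^sup>+t. w t * indicator {eval_form g x..} t \<partial>lborel) \<partial>lborel) =
    ennreal (vol g) * (\<integral>\<^sup>+t. ennreal (indicator {0..} t * t powr (CARD('n) / CARD('d))) * w t \<partial>lborel)"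
proof -
  have meas: "(\<lambda>(x, t). w t * indicator {eval_form g x..} t) \<in> borel_measurable (lborel \<Otimes>\<^sub>M lborel)"
    by (simp add: indicator_def) measurable
  have vol: "emeasure lborel (sublevel g) = ennreal (vol g)"
    using g by (simp add: vol_def finite_volume_forms_def emeasure_eq_ennreal_measure)
  have "(\<integral>\<^sup>+x. (\<integral>\<^sup>+t. w t * indicator {eval_form g x..} t \<partial>lborel) \<partial>lborel) =
      (\<integral>\<^sup>+t. (\<integral>\<^sup>+x. w t * indicator {eval_form g x..} t \<partial>lborel) \<partial>lborel)"
    using lborel_pair.Fubini'[OF meas] by simp
  also have "\<dots> = (\<integral>\<^sup>+t. w t * emeasure lborel {x. eval_form g x \<le> t} \<partial>lborel)"
  proof (intro nn_integral_cong)
    fix t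
    have "(\<integral>\<^sup>+x. w t * indicator {eval_form g x..} t \<partial>lborel) =
        (\<integral>\<^sup>+x. w t * indicator {x. eval_form g x \<le> t} x \<partial>lborel)"
      by (intro nn_integral_cong) (auto simp: indicator_def)
    then show "(\<integral>\<^sup>+x. w t * indicator {eval_form g x..} t \<partial>lborel) =
        w t * emeasure lborel {x. eval_form g x \<le> t}"
      by (simp add: nn_integral_cmult_indicator)
  qed
  also have "\<dots> = (\<integral>\<^sup>+t. ennreal (vol g) *
      (ennreal (indicator {0..} t * t powr (CARD('n) / CARD('d))) * w t) \<partial>lborel)"
  proof (rule nn_integral_cong_AE)
    show "AE t in lborel. w t * emeasure lborel {x. eval_form g x \<le> t} =
        ennreal (vol g) * (ennreal (indicator {0..} t * t powr (CARD('n) / CARD('d))) * w t)"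
      using AE_lborel_singleton[of "0 :: real"]
    proof eventually_elim
      case (elim t)
      show ?case
      proof (cases "0 < t")
        case True
        then show ?thesis
          by (simp add: emeasure_sublevel_dilate vol mult_ac)
      next
        case False
        then have "t < 0" using elim by simp
        then have "{x. eval_form g x \<le> t} = {}"
          using finite_volume_imp_nonneg[OF g] by (auto simp: not_le intro: less_le_trans)
        then show ?thesis using \<open>t < 0\<close> by simp
      qed
    qed
  qed
  also have "\<dots> = ennreal (vol g) *
      (\<integral>\<^sup>+t. ennreal (indicator {0..} t * t powr (CARD('n) / CARD('d))) * w t \<partial>lborel)"
    by (intro nn_integral_cmult) measurable
  finally show ?thesis .
qed

lemma nn_integral_powr_exp:
  assumes "0 \<le> a"
  shows "(\<integral>\<^sup>+t. ennreal (indicator {0..} t * t powr a) * ennreal (t ^ k * exp (- t)) \<partial>lborel) =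
    ennreal (Gamma (1 + (a + real k)))"
proof -
  have "(\<integral>\<^sup>+t. ennreal (indicator {0..} t * t powr a) * ennreal (t ^ k * exp (- t)) \<partial>lborel) =
      (\<integral>\<^sup>+t. ennreal (indicator {0..} t * t powr ((1 + (a + real k)) - 1) / exp t) \<partial>lborel)"
  proof (rule nn_integral_cong_AE)
    show "AE t in lborel. ennreal (indicator {0..} t * t powr a) * ennreal (t ^ k * exp (- t)) =
        ennreal (indicator {0..} t * t powr ((1 + (a + real k)) - 1) / exp t)"
      using AE_lborel_singleton[of "0 :: real"]
    proof eventually_elim
      case (elim t)
      show ?case
      proof (cases "0 < t")
        case True
        then show ?thesis
          by (simp add: ennreal_mult[symmetric] powr_add powr_realpow exp_minus divide_inverse mult_ac)
      next
        case False
        then show ?thesis using elim by simp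
      qed
    qed
  qed
  also have "\<dots> = ennreal (Gamma (1 + (a + real k)))"
    using assms by (intro Gamma_conv_nn_integral_real[symmetric]) simp
  finally show ?thesis .
qed

text \<open>
  The two weights that represent \<open>exp (- s)\<close> and \<open>(1 + s) * exp (- s)\<close> as tail integrals.  The second
  carries the summand \<open>1\<close> because \<open>s * exp (- s)\<close> is not monotone, so it is not the tail integral of a
  nonnegative weight.  The factors \<open>t ^ 0\<close> and \<open>t ^ 1\<close> match the form of \<open>nn_integral_powr_exp\<close>.
\<close>

lemma nn_integral_exp_tail:
  assumes "0 \<le> s"
  shows "(\<integral>\<^sup>+t. ennreal (t ^ 0 * exp (- t)) * indicator {s..} t \<partial>lborel) = ennreal (exp (- s))"
    and "(\<integral>\<^sup>+t. ennreal (t ^ 1 * exp (- t)) * indicator {s..} t \<partial>lborel) = ennreal ((1 + s) * exp (- s))"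
proof -
  have "((\<lambda>t. - exp (- t)) \<longlongrightarrow> 0) (at_top :: real filter)"
    using tendsto_minus[OF filterlim_compose[OF exp_at_bot filterlim_uminus_at_bot_at_top]] by simp
  then show "(\<integral>\<^sup>+t. ennreal (t ^ 0 * exp (- t)) * indicator {s..} t \<partial>lborel) = ennreal (exp (- s))"
    using nn_integral_FTC_atLeast[where f = "\<lambda>t. t ^ 0 * exp (- t)" and F = "\<lambda>t. - exp (- t)" and a = s and T = 0]
    by (simp; force intro!: derivative_eq_intros)
  have "((\<lambda>t. - ((1 + t) / exp t)) \<longlongrightarrow> - 0) (at_top :: real filter)"
    using tendsto_add[OF tendsto_power_div_exp_0[of 0] tendsto_power_div_exp_0[of 1]]
    by (intro tendsto_minus) (simp add: add_divide_distrib)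
  then have "((\<lambda>t. - ((1 + t) * exp (- t))) \<longlongrightarrow> 0) (at_top :: real filter)"
    by (simp add: exp_minus divide_inverse)
  moreover have "((\<lambda>t. - ((1 + t) * exp (- t))) has_real_derivative t ^ 1 * exp (- t)) (at t)" for t :: real
    by (auto intro!: derivative_eq_intros simp: algebra_simps)
  ultimately have "(\<integral>\<^sup>+t. ennreal (t ^ 1 * exp (- t)) * indicator {s..} t \<partial>lborel) =
      ennreal (0 - - ((1 + s) * exp (- s)))"
    using assms by (intro nn_integral_FTC_atLeast) auto
  then show "(\<integral>\<^sup>+t. ennreal (t ^ 1 * exp (- t)) * indicator {s..} t \<partial>lborel) = ennreal ((1 + s) * exp (- s))"
    by simp
qed

lemma nonneg_integral_of_nn_integral:
  assumes "f \<in> borel_measurable M" "\<And>x. 0 \<le> f x" "0 \<le> r" "(\<integral>\<^sup>+x. ennreal (f x) \<partial>M) = ennreal r"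
  shows "integrable M f" "integral\<^sup>L M f = r"
proof -
  show "integrable M f"
    using assms by (intro integrableI_nonneg) auto
  show "integral\<^sup>L M f = r"
    using assms by (simp add: integral_eq_nn_integral)
qed

lemma vol_nonneg: "0 \<le> vol g"
  by (simp add: vol_def)

lemma Gamma_pos: "0 < Gamma (1 + CARD('n::finite) / CARD('d::finite))"
  by (intro Gamma_real_pos) (simp add: add_pos_nonneg)

lemma exp_integral:
  fixes g :: "('n::finite, 'd::finite) form"
  assumes g: "g \<in> finite_volume_forms"
  shows integrable_exp: "integrable lborel (\<lambda>x. exp (- eval_form g x))"
    and integral_exp: "(LINT x|lborel. exp (- eval_form g x)) = Gamma (1 + CARD('n) / CARD('d)) * vol g"
proof -
  have "(\<integral>\<^sup>+x. ennreal (exp (- eval_form g x)) \<partial>lborel) =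
      (\<integral>\<^sup>+x. (\<integral>\<^sup>+t. ennreal (t ^ 0 * exp (- t)) * indicator {eval_form g x..} t \<partial>lborel) \<partial>lborel)"
    using nn_integral_exp_tail(1) finite_volume_imp_nonneg[OF g] by simp
  also have "\<dots> = ennreal (vol g) * ennreal (Gamma (1 + (CARD('n) / CARD('d) + real 0)))"
    by (subst nn_integral_layer_cake[OF g]) (measurable, subst nn_integral_powr_exp, simp_all)
  also have "\<dots> = ennreal (Gamma (1 + CARD('n) / CARD('d)) * vol g)"
    using Gamma_pos[where 'n = 'n and 'd = 'd] by (simp add: ennreal_mult[symmetric] vol_nonneg mult.commute)
  finally have *: "(\<integral>\<^sup>+x. ennreal (exp (- eval_form g x)) \<partial>lborel) =
      ennreal (Gamma (1 + CARD('n) / CARD('d)) * vol g)" .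
  have nonneg: "0 \<le> Gamma (1 + CARD('n) / CARD('d)) * vol g"
    using Gamma_pos[where 'n = 'n and 'd = 'd] vol_nonneg[of g] by simp
  show "integrable lborel (\<lambda>x. exp (- eval_form g x))"
    by (rule nonneg_integral_of_nn_integral(1)[OF _ _ nonneg *]) simp_all
  show "(LINT x|lborel. exp (- eval_form g x)) = Gamma (1 + CARD('n) / CARD('d)) * vol g"
    by (rule nonneg_integral_of_nn_integral(2)[OF _ _ nonneg *]) simp_all
qed

text \<open>
  The weight \<open>t * exp (- t)\<close> computes the integral of \<open>(1 + g) * exp (- g)\<close>; subtracting that of
  \<open>exp (- g)\<close> leaves the factor \<open>n / d\<close>, by the functional equation of Gamma.
\<close>

lemma form_exp_integral:
  fixes g :: "('n::finite, 'd::finite) form"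
  assumes g: "g \<in> finite_volume_forms"
  shows integrable_form_exp: "integrable lborel (\<lambda>x. eval_form g x * exp (- eval_form g x))"
    and integral_form_exp: "(LINT x|lborel. eval_form g x * exp (- eval_form g x)) =
      CARD('n) / CARD('d) * (LINT x|lborel. exp (- eval_form g x))"
proof -
  let ?a = "CARD('n) / CARD('d)"
  have Gamma_step: "Gamma (1 + (?a + 1)) = (1 + ?a) * Gamma (1 + ?a)"
  proof -
    have "0 < 1 + ?a" by (simp add: add_pos_nonneg)
    then have "1 + ?a \<notin> \<int>\<^sub>\<le>\<^sub>0" by (auto elim!: nonpos_Ints_cases)
    then show ?thesis using Gamma_plus1[of "1 + ?a"] by (simp add: add_ac)
  qed
  have "(\<integral>\<^sup>+x. ennreal ((1 + eval_form g x) * exp (- eval_form g x)) \<partial>lborel) =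
      (\<integral>\<^sup>+x. (\<integral>\<^sup>+t. ennreal (t ^ 1 * exp (- t)) * indicator {eval_form g x..} t \<partial>lborel) \<partial>lborel)"
    using nn_integral_exp_tail(2) finite_volume_imp_nonneg[OF g] by simp
  also have "\<dots> = ennreal (vol g) * ennreal (Gamma (1 + (?a + real 1)))"
    by (subst nn_integral_layer_cake[OF g]) (measurable, subst nn_integral_powr_exp, simp_all)
  also have "\<dots> = ennreal ((1 + ?a) * (Gamma (1 + ?a) * vol g))"
    using Gamma_pos[where 'n = 'n and 'd = 'd] by (simp only: of_nat_1 Gamma_step) (simp add: ennreal_mult[symmetric] vol_nonneg mult_ac)
  finally have *: "(\<integral>\<^sup>+x. ennreal ((1 + eval_form g x) * exp (- eval_form g x)) \<partial>lborel) =
      ennreal ((1 + ?a) * (Gamma (1 + ?a) * vol g))" .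
  have "0 \<le> (1 + ?a) * (Gamma (1 + ?a) * vol g)"
    using Gamma_pos[where 'n = 'n and 'd = 'd] vol_nonneg[of g] by simp
  note ** = nonneg_integral_of_nn_integral[OF _ _ this *]
  have int: "integrable lborel (\<lambda>x. (1 + eval_form g x) * exp (- eval_form g x))"
    using finite_volume_imp_nonneg[OF g] by (intro **) simp_all
  have val: "(LINT x|lborel. (1 + eval_form g x) * exp (- eval_form g x)) =
      (1 + ?a) * (Gamma (1 + ?a) * vol g)"
    using finite_volume_imp_nonneg[OF g] by (intro **) simp_all
  have eq: "eval_form g x * exp (- eval_form g x) =
      (1 + eval_form g x) * exp (- eval_form g x) - exp (- eval_form g x)" for x
    by (simp add: algebra_simps)
  show "integrable lborel (\<lambda>x. eval_form g x * exp (- eval_form g x))"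
    unfolding eq by (intro Bochner_Integration.integrable_diff int integrable_exp[OF g])
  show "(LINT x|lborel. eval_form g x * exp (- eval_form g x)) =
      ?a * (LINT x|lborel. exp (- eval_form g x))"
    unfolding eq by (subst Bochner_Integration.integral_diff[OF int integrable_exp[OF g]])
      (simp only: val integral_exp[OF g], simp add: algebra_simps)
qed

section \<open>Strict convexity and lower semicontinuity\<close>

text \<open>
  At the point \<open>c = u * a + v * b\<close> the graph of \<open>exp\<close> lies above its tangent, strictly so away from
  \<open>c\<close>; average the tangent inequality at \<open>a\<close> and \<open>b\<close>.
\<close>

lemma exp_strict_convex:
  fixes a b :: real
  assumes "0 < u" "0 < v" "u + v = 1" "a \<noteq> b"
  shows "exp (u * a + v * b) < u * exp a + v * exp b"
proof -
  have tangent: "1 + t < exp t" if "t \<noteq> 0" for t :: real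
    using exp_minus_greater[of "-t"] that by simp
  define c where "c = u * a + v * b"
  have ac: "a - c = v * (a - b)" and bc: "b - c = - (u * (a - b))"
    using assms(3) by (simp_all add: c_def algebra_simps flip: distrib_right distrib_left eq_diff_eq)
  have "1 = u * (1 + (a - c)) + v * (1 + (b - c))"
    using assms(3) unfolding ac bc by (simp add: algebra_simps)
  also have "\<dots> < u * exp (a - c) + v * exp (b - c)"
    using assms ac bc by (intro add_strict_mono mult_strict_left_mono tangent) auto
  finally have "exp c * 1 < exp c * (u * exp (a - c) + v * exp (b - c))"
    by (intro mult_strict_left_mono) auto
  then show ?thesis
    by (simp add: distrib_left mult.left_commute[of "exp c"] flip: exp_add c_def)
qed

lemma exp_convex:
  fixes a b :: real
  assumes "0 < u" "0 < v" "u + v = 1"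
  shows "exp (u * a + v * b) \<le> u * exp a + v * exp b"
  using exp_strict_convex[OF assms, of a b] assms
  by (cases "a = b") (auto simp flip: distrib_right)

text \<open>
  Where both forms exceed \<open>1\<close>, so does their convex combination; hence its sublevel set is covered by
  the other two.
\<close>

lemma convex_finite_volume_forms: "convex (finite_volume_forms :: ('n::finite, 'd::finite) form set)"
proof (rule convexI)
  fix g h :: "('n, 'd) form" and u v :: real
  assume gh: "g \<in> finite_volume_forms" "h \<in> finite_volume_forms" and uv: "0 \<le> u" "0 \<le> v" "u + v = 1"
  have "sublevel (u *\<^sub>R g + v *\<^sub>R h) \<subseteq> sublevel g \<union> sublevel h"
  proof (rule subsetI, rule ccontr)
    fix x assume x: "x \<in> sublevel (u *\<^sub>R g + v *\<^sub>R h)" "x \<notin> sublevel g \<union> sublevel h"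
    then have "1 < eval_form g x" "1 < eval_form h x"
      by (auto simp: sublevel_def)
    then have "1 < u * eval_form g x + v * eval_form h x"
      using convex_bound_lt[of "- eval_form g x" "- 1" "- eval_form h x" u v] uv by simp
    then show False using x(1) by (simp add: sublevel_def eval_form_add eval_form_scaleR)
  qed
  then have "emeasure lborel (sublevel (u *\<^sub>R g + v *\<^sub>R h)) \<le> emeasure lborel (sublevel g \<union> sublevel h)"
    by (rule emeasure_mono) (simp add: sublevel_def)
  also have "\<dots> \<le> emeasure lborel (sublevel g) + emeasure lborel (sublevel h)"
    by (rule emeasure_subadditive) (simp_all add: sublevel_def)
  also have "\<dots> < \<infinity>"
    using gh by (simp add: finite_volume_forms_def)
  finally show "u *\<^sub>R g + v *\<^sub>R h \<in> finite_volume_forms"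
    by (simp add: finite_volume_forms_def)
qed

lemma integral_pos_if_continuous:
  fixes f :: "'a::euclidean_space \<Rightarrow> real"
  assumes int: "integrable lborel f" and cont: "continuous_on UNIV f"
    and nonneg: "\<And>x. 0 \<le> f x" and pos: "0 < f y"
  shows "0 < integral\<^sup>L lborel f"
proof -
  have "open {x. 0 < f x}"
    using cont by (intro open_Collect_less continuous_intros)
  then have "0 < emeasure lborel {x. 0 < f x}"
    using pos by (intro emeasure_lborel_open_pos) auto
  moreover have [measurable]: "f \<in> borel_measurable borel"
    by (rule borel_measurable_continuous_onI) (rule cont)
  have "emeasure lborel {x. 0 < f x} = 0" if "AE x in lborel. f x = 0"
    using emeasure_eq_0_AE[of "\<lambda>x. 0 < f x" lborel] eventually_mono[OF that, of "\<lambda>x. \<not> 0 < f x"] by simp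
  ultimately have "\<not> (AE x in lborel. f x = 0)"
    by auto
  then have "integral\<^sup>L lborel f \<noteq> 0"
    using integral_nonneg_eq_0_iff_AE[OF int] nonneg by simp
  moreover have "0 \<le> integral\<^sup>L lborel f"
    using nonneg by (intro integral_nonneg_AE) simp
  ultimately show ?thesis by simp
qed

lemma vol_eq_integral_exp:
  fixes g :: "('n::finite, 'd::finite) form"
  assumes "g \<in> finite_volume_forms"
  shows "vol g = 1 / Gamma (1 + CARD('n) / CARD('d)) * (LINT x|lborel. exp (- eval_form g x))"
  using integral_exp[OF assms] Gamma_pos[where 'n = 'n and 'd = 'd] by (simp add: less_imp_neq[symmetric])

text \<open>
  The convexity defect of \<open>g \<mapsto> \<integral> exp (- g)\<close> is the integral of a continuous nonnegative function that
  is positive wherever the two forms differ.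
\<close>

lemma strictly_convex_vol:
  "strictly_convex_on (finite_volume_forms :: ('n::finite, 'd::finite) form set) vol"
  unfolding strictly_convex_on_def
proof (intro conjI ballI allI impI)
  show "convex (finite_volume_forms :: ('n, 'd) form set)"
    by (rule convex_finite_volume_forms)
  fix g h :: "('n, 'd) form" and u v :: real
  assume gh: "g \<in> finite_volume_forms" "h \<in> finite_volume_forms"
    and uv: "0 < u" "0 < v" "u + v = 1" and "g \<noteq> h"
  let ?k = "u *\<^sub>R g + v *\<^sub>R h"
  have k: "?k \<in> finite_volume_forms"
    using convexD[OF convex_finite_volume_forms gh, of u v] uv by simp
  define f where "f x = u * exp (- eval_form g x) + v * exp (- eval_form h x) - exp (- eval_form ?k x)" for x
  have arg: "- eval_form ?k x = u * (- eval_form g x) + v * (- eval_form h x)" for x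
    by (simp add: eval_form_add eval_form_scaleR)
  obtain y where "eval_form g y \<noteq> eval_form h y"
    using form_eq_0[of "g - h"] \<open>g \<noteq> h\<close> by (auto simp: eval_form_diff)
  then have pos: "0 < f y"
    unfolding f_def arg using exp_strict_convex[OF uv, of "- eval_form g y" "- eval_form h y"] by simp
  have nonneg: "0 \<le> f x" for x
    unfolding f_def arg using exp_convex[OF uv, of "- eval_form g x" "- eval_form h x"] by simp
  note ints = integrable_exp[OF gh(1)] integrable_exp[OF gh(2)] integrable_exp[OF k]
  have "integrable lborel f"
    unfolding f_def using ints by simp
  moreover have "continuous_on UNIV f"
    unfolding f_def by (intro continuous_intros continuous_on_eval_form)
  ultimately have "0 < integral\<^sup>L lborel f"
    using nonneg pos by (rule integral_pos_if_continuous)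
  also have "integral\<^sup>L lborel f = u * (LINT x|lborel. exp (- eval_form g x)) +
      v * (LINT x|lborel. exp (- eval_form h x)) - (LINT x|lborel. exp (- eval_form ?k x))"
    unfolding f_def using ints by simp
  also have "\<dots> = Gamma (1 + CARD('n) / CARD('d)) * (u * vol g + v * vol h - vol ?k)"
    by (simp add: integral_exp gh k algebra_simps)
  finally show "vol ?k < u * vol g + v * vol h"
    using Gamma_pos[where 'n = 'n and 'd = 'd] by (simp add: zero_less_mult_iff)
qed

text \<open>
  Fatou's lemma along sequences: evaluation at a fixed point is continuous in the coefficients.
\<close>

lemma lower_semicontinuous_vol:
  "lower_semicontinuous_on (finite_volume_forms :: ('n::finite, 'd::finite) form set) vol"
  unfolding lower_semicontinuous_on_def
proof (intro ballI allI impI sequentially_imp_eventually_within)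
  fix g :: "('n, 'd) form" and c and s :: "nat \<Rightarrow> ('n, 'd) form"
  assume g: "g \<in> finite_volume_forms" and c: "c < vol g"
    and s: "(\<forall>n. s n \<in> finite_volume_forms \<and> s n \<noteq> g) \<and> s \<longlonglongrightarrow> g"
  let ?I = "\<lambda>g :: ('n, 'd) form. \<integral>\<^sup>+x. ennreal (exp (- eval_form g x)) \<partial>lborel"
  let ?G = "Gamma (1 + CARD('n) / CARD('d))"
  have I: "?I h = ennreal (?G * vol h)" if "h \<in> finite_volume_forms" for h :: "('n, 'd) form"
    using integral_exp[OF that] by (simp add: nn_integral_eq_integral integrable_exp that)
  show "\<forall>\<^sub>F n in sequentially. c < vol (s n)"
  proof (cases "0 \<le> c")
    case False
    then show ?thesis
      by (intro always_eventually allI less_le_trans[OF _ vol_nonneg]) simp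
  next
    case True
    have lim: "(\<lambda>n. ennreal (exp (- eval_form (s n) x))) \<longlonglongrightarrow> ennreal (exp (- eval_form g x))" for x
    proof -
      have "isCont (\<lambda>g :: ('n, 'd) form. eval_form g x) g"
        using continuous_on_coeffs_eval_form[of "UNIV :: ('n, 'd) form set" x] by (simp add: continuous_on_eq_continuous_at)
      then show ?thesis
        using s by (intro tendsto_ennrealI tendsto_exp tendsto_minus) (auto intro: isCont_tendsto_compose)
    qed
    have "ennreal (?G * c) < ?I g"
      using Gamma_pos[where 'n = 'n and 'd = 'd] True c by (simp add: I g ennreal_lessI)
    also have "?I g = (\<integral>\<^sup>+x. liminf (\<lambda>n. ennreal (exp (- eval_form (s n) x))) \<partial>lborel)"
      by (intro nn_integral_cong lim_imp_Liminf[symmetric] lim) simp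
    also have "\<dots> \<le> liminf (\<lambda>n. ?I (s n))"
      by (intro nn_integral_liminf) simp
    finally have "\<forall>\<^sub>F n in sequentially. ennreal (?G * c) < ?I (s n)"
      by (rule less_LiminfD)
    then show ?thesis
    proof eventually_elim
      case (elim n)
      then show ?case
        using s Gamma_pos[where 'n = 'n and 'd = 'd] True by (simp add: I ennreal_less_iff)
    qed
  qed
qed

section \<open>Moments of exp(-g) for coercive forms\<close>

text \<open>
  The sublevel set of a form that dominates a positive multiple of the power form is bounded.
\<close>

lemma power_form_coercive_finite_volume:
  fixes g :: "('n::finite, 'd::finite) form"
  assumes "even CARD('d)" "0 < \<epsilon>"
    and lower: "\<And>x. \<epsilon> * eval_form (power_form :: ('n, 'd) form) x \<le> eval_form g x"
  shows "g \<in> finite_volume_forms"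
proof -
  have "\<bar>x $ i\<bar> \<le> max 1 (1 / \<epsilon>)" if "x \<in> sublevel g" for x i
  proof (cases "\<bar>x $ i\<bar> \<le> 1")
    case False
    have "\<bar>x $ i\<bar> ^ 1 \<le> \<bar>x $ i\<bar> ^ CARD('d)"
      using False by (intro power_increasing) (auto simp: Suc_le_eq)
    also have "\<dots> = (x $ i) ^ CARD('d)"
      using assms(1) by (simp add: power_even_abs)
    also have "\<dots> \<le> eval_form (power_form :: ('n, 'd) form) x"
      unfolding eval_power_form using assms(1)
      by (intro member_le_sum) (auto simp: zero_le_even_power)
    also have "\<dots> \<le> 1 / \<epsilon>"
      using lower[of x] that \<open>0 < \<epsilon>\<close> by (simp add: sublevel_def field_simps)
    finally show ?thesis by simp
  qed simp
  then have "sublevel g \<subseteq> cbox (\<chi> i. - max 1 (1 / \<epsilon>)) (\<chi> i. max 1 (1 / \<epsilon>))"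
    by (auto simp: mem_box_cart abs_le_iff minus_le_iff)
  then have "emeasure lborel (sublevel g) < \<infinity>"
    by (intro emeasure_bounded_finite bounded_subset[OF bounded_cbox])
  then show ?thesis by (simp add: finite_volume_forms_def)
qed

text \<open>
  Subtracting a small multiple of the power form stays inside the set of finite-volume forms, whose
  members are nonnegative.
\<close>

lemma interior_imp_coercive:
  fixes g :: "('n::finite, 'd::finite) form"
  assumes "g \<in> interior finite_volume_forms"
  obtains \<epsilon> where "0 < \<epsilon>" "\<And>x. \<epsilon> * eval_form (power_form :: ('n, 'd) form) x \<le> eval_form g x"
proof -
  obtain r where r: "0 < r" "ball g r \<subseteq> finite_volume_forms"
    using assms by (meson mem_interior)
  let ?p = "power_form :: ('n, 'd) form"
  \<comment> \<open>The summand \<open>1\<close> keeps \<open>\<epsilon>\<close> times the norm strictly below \<open>r\<close>.\<close>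
  define \<epsilon> where "\<epsilon> = r / (1 + norm ?p)"
  have "0 < \<epsilon>"
    using r(1) by (simp add: \<epsilon>_def add_pos_nonneg)
  have "\<epsilon> * norm ?p < \<epsilon> * (1 + norm ?p)"
    using \<open>0 < \<epsilon>\<close> by (intro mult_strict_left_mono) auto
  also have "\<dots> = r"
    by (simp add: \<epsilon>_def add_pos_nonneg less_imp_neq[symmetric])
  finally have "g - \<epsilon> *\<^sub>R ?p \<in> ball g r"
    using \<open>0 < \<epsilon>\<close> by (simp add: dist_norm)
  then have "0 \<le> eval_form (g - \<epsilon> *\<^sub>R ?p) x" for x
    using r(2) finite_volume_imp_nonneg by blast
  then show thesis
    using that[OF \<open>0 < \<epsilon>\<close>] by (simp add: eval_form_diff eval_form_scaleR)
qed

text \<open>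
  From \<open>s \<le> exp s\<close> at \<open>s = c * t / (k + 1)\<close>, raised to the power \<open>k\<close>; dividing by \<open>k + 1\<close> and not by
  \<open>k\<close> includes the case \<open>k = 0\<close>.
\<close>

lemma power_le_exp:
  fixes t c :: real
  assumes "0 \<le> t" "0 < c"
  shows "t ^ k \<le> (real (Suc k) / c) ^ k * exp (c * t)"
proof -
  let ?s = "c * t / real (Suc k)"
  have "0 \<le> ?s" using assms by simp
  have "?s \<le> exp ?s"
    using exp_ge_add_one_self[of ?s] by linarith
  then have "?s ^ k \<le> exp ?s ^ k"
    using \<open>0 \<le> ?s\<close> by (intro power_mono)
  also have "\<dots> = exp (real k * ?s)"
    by (simp only: exp_of_nat_mult)
  also have "\<dots> \<le> exp (c * t)"
  proof -
    have "real k * ?s \<le> real (Suc k) * ?s"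
      using \<open>0 \<le> ?s\<close> by (intro mult_right_mono) auto
    then show ?thesis by simp
  qed
  finally have "(real (Suc k) / c) ^ k * ?s ^ k \<le> (real (Suc k) / c) ^ k * exp (c * t)"
    using assms by (intro mult_left_mono) auto
  moreover have "(real (Suc k) / c) ^ k * ?s ^ k = t ^ k"
    using assms by (simp add: power_mult_distrib[symmetric] del: of_nat_Suc)
  ultimately show ?thesis by simp
qed

text \<open>
  Half of the exponential decay absorbs the power of \<open>q\<close>, and the other half is integrable because
  \<open>(\<epsilon> / 2) * q\<close> is itself a form of finite volume.
\<close>

lemma integrable_power_form_exp:
  assumes "even CARD('d)" "0 < \<epsilon>"
  shows "integrable lborel (\<lambda>x. eval_form (power_form :: ('n::finite, 'd::finite) form) x ^ k *
    exp (- (\<epsilon> * eval_form (power_form :: ('n, 'd) form) x)))"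
proof -
  let ?p = "power_form :: ('n, 'd) form"
  let ?q = "eval_form ?p"
  let ?C = "(real (Suc k) / (\<epsilon> / 2)) ^ k"
  have "(\<epsilon> / 2) *\<^sub>R ?p \<in> finite_volume_forms"
    using assms by (intro power_form_coercive_finite_volume[of "\<epsilon> / 2"]) (simp_all add: eval_form_scaleR)
  from integrable_exp[OF this] have int: "integrable lborel (\<lambda>x. ?C * exp (- (\<epsilon> / 2 * ?q x)))"
    by (simp add: eval_form_scaleR)
  show ?thesis
  proof (rule Bochner_Integration.integrable_bound[OF int])
    show "AE x in lborel. norm (?q x ^ k * exp (- (\<epsilon> * ?q x))) \<le> norm (?C * exp (- (\<epsilon> / 2 * ?q x)))"
    proof (intro AE_I2)
      fix x :: "real ^ 'n"
      have q: "0 \<le> ?q x" using assms(1) by (rule eval_power_form_nonneg)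
      have "?q x ^ k * exp (- (\<epsilon> * ?q x)) \<le> (?C * exp (\<epsilon> / 2 * ?q x)) * exp (- (\<epsilon> * ?q x))"
        using q assms(2) by (intro mult_right_mono power_le_exp) auto
      also have "\<dots> = ?C * exp (- (\<epsilon> / 2 * ?q x))"
        by (simp add: mult.assoc exp_add[symmetric] del: of_nat_Suc)
      finally show "norm (?q x ^ k * exp (- (\<epsilon> * ?q x))) \<le> norm (?C * exp (- (\<epsilon> / 2 * ?q x)))"
        using q assms(2) by (simp add: abs_mult)
    qed
  qed simp
qed

lemma integrable_moment:
  fixes g :: "('n::finite, 'd::finite) form"
  assumes "even CARD('d)" "0 < \<epsilon>"
    and lower: "\<And>x. \<epsilon> * eval_form (power_form :: ('n, 'd) form) x \<le> eval_form g x"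
    and [measurable]: "m \<in> borel_measurable borel"
    and m: "\<And>x. \<bar>m x\<bar> \<le> C * eval_form (power_form :: ('n, 'd) form) x ^ k"
  shows "integrable lborel (\<lambda>x. m x * exp (- eval_form g x))"
proof (rule Bochner_Integration.integrable_bound)
  let ?q = "eval_form (power_form :: ('n, 'd) form)"
  show "integrable lborel (\<lambda>x. C * (?q x ^ k * exp (- (\<epsilon> * ?q x))))"
    using assms(1,2) by (intro integrable_mult_right integrable_power_form_exp)
  show "AE x in lborel. norm (m x * exp (- eval_form g x)) \<le> norm (C * (?q x ^ k * exp (- (\<epsilon> * ?q x))))"
  proof (intro AE_I2)
    fix x
    have "norm (m x * exp (- eval_form g x)) = \<bar>m x\<bar> * exp (- eval_form g x)"
      by (simp add: abs_mult)
    also have "\<dots> \<le> (C * ?q x ^ k) * exp (- (\<epsilon> * ?q x))"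
      using m[of x] lower[of x] by (intro mult_mono) auto
    also have "\<dots> \<le> norm (C * (?q x ^ k * exp (- (\<epsilon> * ?q x))))"
      by (simp only: mult.assoc real_norm_def abs_ge_self)
    finally show "norm (m x * exp (- eval_form g x)) \<le> norm (C * (?q x ^ k * exp (- (\<epsilon> * ?q x))))" .
  qed
qed simp

lemma exp_second_order:
  fixes y :: real
  shows "\<bar>exp y - 1 - y\<bar> \<le> y\<^sup>2 * exp \<bar>y\<bar>"
proof -
  obtain t where t: "\<bar>t\<bar> \<le> \<bar>y\<bar>" "exp y = (\<Sum>m<2. y ^ m / fact m) + exp t / fact 2 * y\<^sup>2"
    using Maclaurin_exp_le[of y 2] by blast
  then have "\<bar>exp y - 1 - y\<bar> = exp t / 2 * y\<^sup>2"
    by (simp add: numeral_2_eq_2)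
  also have "\<dots> \<le> exp \<bar>y\<bar> * y\<^sup>2"
  proof (intro mult_right_mono)
    have "exp t / 2 \<le> exp t" by simp
    also have "\<dots> \<le> exp \<bar>y\<bar>" using t(1) by simp
    finally show "exp t / 2 \<le> exp \<bar>y\<bar>" .
  qed simp
  finally show ?thesis by (simp add: mult.commute)
qed

text \<open>
  Differentiation under the integral, with an explicit quadratic error.  For \<open>N * norm h \<le> \<epsilon> / 2\<close>
  the perturbation is bounded by \<open>(\<epsilon> / 2) * q\<close>, so the error in \<open>exp (- g - h)\<close> to first order is at
  most \<open>(N * norm h * q)\<^sup>2 * exp (- (\<epsilon> / 2) * q)\<close> pointwise, with \<open>N\<close> the number of monomials.
\<close>

lemma moment_has_derivative:
  fixes g :: "('n::finite, 'd::finite) form"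
  assumes "even CARD('d)" "0 < \<epsilon>"
    and lower: "\<And>x. \<epsilon> * eval_form (power_form :: ('n, 'd) form) x \<le> eval_form g x"
    and m_meas [measurable]: "m \<in> borel_measurable borel"
    and m: "\<And>x. \<bar>m x\<bar> \<le> eval_form (power_form :: ('n, 'd) form) x ^ k"
  shows "((\<lambda>g :: ('n, 'd) form. LINT x|lborel. m x * exp (- eval_form g x)) has_derivative
    (\<lambda>h. - (LINT x|lborel. m x * eval_form h x * exp (- eval_form g x)))) (at g)"
proof -
  let ?q = "eval_form (power_form :: ('n, 'd) form)"
  let ?F = "\<lambda>g :: ('n, 'd) form. LINT x|lborel. m x * exp (- eval_form g x)"
  let ?D = "\<lambda>h :: ('n, 'd) form. - (LINT x|lborel. m x * eval_form h x * exp (- eval_form g x))"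
  define N where "N = real CARD(('n, 'd) multi_index)"
  have "0 < N" by (simp add: N_def)
  have q: "0 \<le> ?q x" for x
    using assms(1) by (rule eval_power_form_nonneg)
  have h: "\<bar>eval_form h x\<bar> \<le> N * norm h * ?q x" for h :: "('n, 'd) form" and x
    unfolding N_def using assms(1) by (rule abs_eval_form_le)
  have mh: "\<bar>m x * eval_form h x\<bar> \<le> N * norm h * ?q x ^ Suc k" for h :: "('n, 'd) form" and x
  proof -
    have "\<bar>m x * eval_form h x\<bar> \<le> ?q x ^ k * (N * norm h * ?q x)"
      unfolding abs_mult using q by (intro mult_mono m h) auto
    then show ?thesis by (simp add: mult_ac)
  qed
  have intD: "integrable lborel (\<lambda>x. m x * eval_form h x * exp (- eval_form g x))" for h :: "('n, 'd) form"
    using assms(1,2) lower _ mh by (rule integrable_moment) simp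
  have "linear ?D"
  proof (rule linearI)
    fix h h' :: "('n, 'd) form" and c :: real
    show "?D (h + h') = ?D h + ?D h'"
      using intD[of h] intD[of h'] by (simp add: eval_form_add distrib_left distrib_right)
    have "(LINT x|lborel. m x * eval_form (c *\<^sub>R h) x * exp (- eval_form g x)) =
        (LINT x|lborel. c * (m x * eval_form h x * exp (- eval_form g x)))"
      by (intro Bochner_Integration.integral_cong) (simp_all add: eval_form_scaleR)
    then show "?D (c *\<^sub>R h) = c *\<^sub>R ?D h" by simp
  qed
  then have bl: "bounded_linear ?D"
    by (simp add: linear_linear)
  define J where "J = (LINT x|lborel. ?q x ^ (k + 2) * exp (- (\<epsilon> / 2 * ?q x)))"
  have remainder: "\<bar>?F y - ?F g - ?D (y - g)\<bar> \<le> (N\<^sup>2 * J) * (norm (y - g))\<^sup>2"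
    if "N * norm (y - g) \<le> \<epsilon> / 2" for y :: "('n, 'd) form"
  proof -
    define h where "h = y - g"
    have y: "eval_form y x = eval_form g x + eval_form h x" for x
      by (simp add: h_def eval_form_diff)
    have small: "\<bar>eval_form h x\<bar> \<le> \<epsilon> / 2 * ?q x" for x
      using h[of h x] mult_right_mono[OF that q[of x]] by (simp add: h_def)
    have low_y: "\<epsilon> / 2 * ?q x \<le> eval_form y x" for x
      using lower[of x] small[of x] by (simp add: y)
    have m': "\<bar>m x\<bar> \<le> 1 * ?q x ^ k" for x
      using m by simp
    have int_y: "integrable lborel (\<lambda>x. m x * exp (- eval_form y x))"
      by (rule integrable_moment[OF assms(1) _ low_y m_meas m']) (use assms(2) in simp)
    have int_g: "integrable lborel (\<lambda>x. m x * exp (- eval_form g x))"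
      by (rule integrable_moment[OF assms(1,2) lower m_meas m'])
    let ?R = "\<lambda>x. m x * exp (- eval_form y x) - m x * exp (- eval_form g x) +
      m x * eval_form h x * exp (- eval_form g x)"
    have "?F y - ?F g - ?D h = (LINT x|lborel. ?R x)"
      using int_y int_g intD[of h] by simp
    also have "\<bar>LINT x|lborel. ?R x\<bar> \<le>
        (LINT x|lborel. N\<^sup>2 * (norm h)\<^sup>2 * (?q x ^ (k + 2) * exp (- (\<epsilon> / 2 * ?q x))))"
    proof (rule integral_abs_bound_integral)
      show "integrable lborel ?R"
        using int_y int_g intD[of h] by simp
      show "integrable lborel (\<lambda>x. N\<^sup>2 * (norm h)\<^sup>2 * (?q x ^ (k + 2) * exp (- (\<epsilon> / 2 * ?q x))))"
        using assms(1,2) by (intro integrable_mult_right integrable_power_form_exp) auto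
      fix x
      let ?t = "- eval_form h x"
      have "\<bar>?R x\<bar> = \<bar>m x\<bar> * (exp (- eval_form g x) * \<bar>exp ?t - 1 - ?t\<bar>)"
      proof -
        have "?R x = m x * (exp (- eval_form g x) * (exp ?t - 1 - ?t))"
          by (simp add: y exp_add[symmetric] algebra_simps)
        then show ?thesis by (simp only: abs_mult abs_exp_cancel)
      qed
      also have "\<dots> \<le> ?q x ^ k * (exp (- (\<epsilon> * ?q x)) * ((N * norm h * ?q x)\<^sup>2 * exp (\<epsilon> / 2 * ?q x)))"
      proof (intro mult_mono m)
        have "\<bar>exp ?t - 1 - ?t\<bar> \<le> \<bar>?t\<bar>\<^sup>2 * exp \<bar>?t\<bar>"
          using exp_second_order[of ?t] by simp
        also have "\<dots> \<le> (N * norm h * ?q x)\<^sup>2 * exp (\<epsilon> / 2 * ?q x)"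
          using h[of h x] small[of x] by (intro mult_mono power_mono) auto
        finally show "\<bar>exp ?t - 1 - ?t\<bar> \<le> (N * norm h * ?q x)\<^sup>2 * exp (\<epsilon> / 2 * ?q x)" .
      qed (use lower[of x] q[of x] in auto)
      also have "\<dots> = N\<^sup>2 * (norm h)\<^sup>2 * (?q x ^ (k + 2) * (exp (- (\<epsilon> * ?q x)) * exp (\<epsilon> / 2 * ?q x)))"
        by (simp only: power_mult_distrib power_add mult_ac)
      also have "exp (- (\<epsilon> * ?q x)) * exp (\<epsilon> / 2 * ?q x) = exp (- (\<epsilon> / 2 * ?q x))"
        by (simp add: exp_add[symmetric])
      finally show "\<bar>?R x\<bar> \<le> N\<^sup>2 * (norm h)\<^sup>2 * (?q x ^ (k + 2) * exp (- (\<epsilon> / 2 * ?q x)))" .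
    qed
    also have "\<dots> = (N\<^sup>2 * J) * (norm h)\<^sup>2"
      by (simp add: J_def)
    finally show ?thesis by (simp add: h_def)
  qed
  show ?thesis
    unfolding has_derivative_at_alt
  proof (intro conjI allI impI)
    show "bounded_linear ?D" by (rule bl)
    fix e :: real assume "0 < e"
    \<comment> \<open>The modulus and the summand \<open>1\<close> make \<open>L\<close> positive without computing the sign of \<open>J\<close>.\<close>
    define L where "L = \<bar>N\<^sup>2 * J\<bar> + 1"
    have "0 < L" by (simp add: L_def add_nonneg_pos)
    define \<delta> where "\<delta> = min (\<epsilon> / 2 / N) (e / L)"
    show "\<exists>d>0. \<forall>y. norm (y - g) < d \<longrightarrow> norm (?F y - ?F g - ?D (y - g)) \<le> e * norm (y - g)"
    proof (intro exI[of _ \<delta>] conjI allI impI)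
      show "0 < \<delta>"
        using \<open>0 < L\<close> \<open>0 < e\<close> \<open>0 < N\<close> assms(2) by (simp add: \<delta>_def)
      fix y :: "('n, 'd) form" assume "norm (y - g) < \<delta>"
      then have "norm (y - g) < \<epsilon> / 2 / N" "norm (y - g) < e / L"
        by (simp_all add: \<delta>_def)
      then have close: "N * norm (y - g) \<le> \<epsilon> / 2" "L * norm (y - g) \<le> e"
        using \<open>0 < N\<close> \<open>0 < L\<close> by (simp_all add: field_simps)
      have "\<bar>?F y - ?F g - ?D (y - g)\<bar> \<le> (N\<^sup>2 * J) * (norm (y - g))\<^sup>2"
        using close(1) by (rule remainder)
      also have "\<dots> \<le> L * (norm (y - g))\<^sup>2"
        by (intro mult_right_mono) (auto simp: L_def)
      also have "\<dots> \<le> e * norm (y - g)"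
        using mult_right_mono[OF close(2), of "norm (y - g)"] by (simp add: power2_eq_square mult_ac)
      finally show "norm (?F y - ?F g - ?D (y - g)) \<le> e * norm (y - g)" by simp
    qed
  qed
qed

lemma moment_gderiv:
  fixes g :: "('n::finite, 'd::finite) form"
  assumes "even CARD('d)" "0 < \<epsilon>"
    and lower: "\<And>x. \<epsilon> * eval_form (power_form :: ('n, 'd) form) x \<le> eval_form g x"
    and m_meas [measurable]: "m \<in> borel_measurable borel"
    and m: "\<And>x. \<bar>m x\<bar> \<le> eval_form (power_form :: ('n, 'd) form) x ^ k"
  shows "GDERIV (\<lambda>g :: ('n, 'd) form. LINT x|lborel. m x * exp (- eval_form g x)) g :>
    (\<chi> \<alpha>. - (LINT x|lborel. m x * monomial (expo \<alpha>) x * exp (- eval_form g x)))"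
proof -
  have int: "integrable lborel (\<lambda>x. m x * monomial (expo \<alpha>) x * exp (- eval_form g x))"
    for \<alpha> :: "('n, 'd) multi_index"
  proof (rule integrable_moment[OF assms(1,2) lower, where C = 1 and k = "Suc k"])
    fix x
    have "\<bar>m x * monomial (expo \<alpha>) x\<bar> \<le> eval_form (power_form :: ('n, 'd) form) x ^ k *
        eval_form (power_form :: ('n, 'd) form) x"
      unfolding abs_mult using assms(1) eval_power_form_nonneg[OF assms(1), where 'n = 'n]
      by (intro mult_mono m abs_monomial_le_power_form) auto
    then show "\<bar>m x * monomial (expo \<alpha>) x\<bar> \<le> 1 * eval_form (power_form :: ('n, 'd) form) x ^ Suc k"
      by (simp add: mult.commute)
  qed simp
  have "- (LINT x|lborel. m x * eval_form h x * exp (- eval_form g x)) =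
      h \<bullet> (\<chi> \<alpha>. - (LINT x|lborel. m x * monomial (expo \<alpha>) x * exp (- eval_form g x)))"
    for h :: "('n, 'd) form"
  proof -
    have "(LINT x|lborel. m x * eval_form h x * exp (- eval_form g x)) =
        (LINT x|lborel. (\<Sum>\<alpha>\<in>UNIV. h $ \<alpha> * (m x * monomial (expo \<alpha>) x * exp (- eval_form g x))))"
      by (intro Bochner_Integration.integral_cong)
        (simp_all add: eval_form_def sum_distrib_left sum_distrib_right mult_ac)
    also have "\<dots> = (\<Sum>\<alpha>\<in>UNIV. h $ \<alpha> * (LINT x|lborel. m x * monomial (expo \<alpha>) x * exp (- eval_form g x)))"
      using int by (subst Bochner_Integration.integral_sum) auto
    finally show ?thesis
      by (simp add: inner_vec_def sum_negf)
  qed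
  then show ?thesis
    unfolding gderiv_def using moment_has_derivative[OF assms] by simp
qed

section \<open>Gradient and Hessian of the volume\<close>

text \<open>
  On the interior, an open set, the volume coincides with the zeroth moment divided by a Gamma value.
\<close>

lemma vol_gderiv:
  fixes g :: "('n::finite, 'd::finite) form"
  assumes "even CARD('d)" and g: "g \<in> interior finite_volume_forms"
  shows "GDERIV vol g :>
    (\<chi> \<alpha>. - 1 / Gamma (1 + real CARD('n) / real CARD('d)) *
      (LINT x|lborel. monomial (expo \<alpha>) x * exp (- eval_form g x)))"
proof -
  let ?c = "1 / Gamma (1 + real CARD('n) / real CARD('d))"
  obtain \<epsilon> where \<epsilon>: "0 < \<epsilon>" "\<And>x. \<epsilon> * eval_form (power_form :: ('n, 'd) form) x \<le> eval_form g x"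
    using interior_imp_coercive[OF g] by blast
  have "GDERIV (\<lambda>g :: ('n, 'd) form. LINT x|lborel. exp (- eval_form g x)) g :>
      (\<chi> \<alpha>. - (LINT x|lborel. monomial (expo \<alpha>) x * exp (- eval_form g x)))"
    using moment_gderiv[OF assms(1) \<epsilon>, of "\<lambda>x. 1" 0] by simp
  then have "((\<lambda>g :: ('n, 'd) form. ?c * (LINT x|lborel. exp (- eval_form g x))) has_derivative
      (\<lambda>h. ?c * (h \<bullet> (\<chi> \<alpha>. - (LINT x|lborel. monomial (expo \<alpha>) x * exp (- eval_form g x)))))) (at g)"
    unfolding gderiv_def by (rule has_derivative_mult_right)
  then have "(vol has_derivative
      (\<lambda>h. ?c * (h \<bullet> (\<chi> \<alpha>. - (LINT x|lborel. monomial (expo \<alpha>) x * exp (- eval_form g x)))))) (at g)"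
    by (rule has_derivative_transform_within_open[OF _ open_interior g])
      (metis interior_subset subsetD vol_eq_integral_exp)
  then show ?thesis
    by (simp add: gderiv_def inner_vec_def sum_distrib_left mult_ac)
qed

text \<open>
  Each component of the gradient is a multiple of the moment of a monomial, and moments are
  differentiable.
\<close>

lemma vol_has_hessian:
  fixes g :: "('n::finite, 'd::finite) form"
  assumes "even CARD('d)" and g: "g \<in> interior finite_volume_forms"
  shows "has_hessian vol
    (\<chi> \<alpha> \<beta>. 1 / Gamma (1 + real CARD('n) / real CARD('d)) *
      (LINT x|lborel. monomial (\<lambda>i. expo \<alpha> i + expo \<beta> i) x * exp (- eval_form g x))) g"
  unfolding has_hessian_def
proof (intro exI conjI)
  let ?c = "1 / Gamma (1 + real CARD('n) / real CARD('d))"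
  let ?M = "\<lambda>\<alpha> (g :: ('n, 'd) form). LINT x|lborel. monomial (expo (\<alpha> :: ('n, 'd) multi_index)) x * exp (- eval_form g x)"
  let ?A = "\<chi> \<alpha> \<beta>. ?c * (LINT x|lborel. monomial (\<lambda>i. expo \<alpha> i + expo \<beta> i) x * exp (- eval_form g x))"
  have "\<forall>\<^sub>F y in nhds g. y \<in> interior finite_volume_forms"
    using g by (intro eventually_nhds_in_open) auto
  then show "\<forall>\<^sub>F y in nhds g. GDERIV vol y :> (\<chi> \<alpha>. - ?c * ?M \<alpha> y)"
    by eventually_elim (use vol_gderiv[OF assms(1)] in simp)
  obtain \<epsilon> where \<epsilon>: "0 < \<epsilon>" "\<And>x. \<epsilon> * eval_form (power_form :: ('n, 'd) form) x \<le> eval_form g x"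
    using interior_imp_coercive[OF g] by blast
  have "((\<lambda>y. - ?c * ?M \<alpha> y) has_derivative (\<lambda>h. (?A *v h) $ \<alpha>)) (at g)" for \<alpha> :: "('n, 'd) multi_index"
  proof -
    have "GDERIV (?M \<alpha>) g :>
        (\<chi> \<beta>. - (LINT x|lborel. monomial (expo \<alpha>) x * monomial (expo \<beta>) x * exp (- eval_form g x)))"
      using assms(1) \<epsilon> by (rule moment_gderiv[where k = 1]) (simp_all add: abs_monomial_le_power_form assms(1))
    then have "((\<lambda>y. - ?c * ?M \<alpha> y) has_derivative
        (\<lambda>h. - ?c * (h \<bullet> (\<chi> \<beta>. - (LINT x|lborel. monomial (expo \<alpha>) x * monomial (expo \<beta>) x * exp (- eval_form g x)))))) (at g)"
      unfolding gderiv_def by (rule has_derivative_mult_right)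
    moreover have "- ?c * (h \<bullet> (\<chi> \<beta>. - (LINT x|lborel. monomial (expo \<alpha>) x * monomial (expo \<beta>) x * exp (- eval_form g x)))) =
        (?A *v h) $ \<alpha>" for h :: "('n, 'd) form"
      by (simp add: inner_vec_def matrix_vector_mult_def monomial_add sum_distrib_left sum_negf mult_ac)
    ultimately show ?thesis by (simp only:)
  qed
  then show "((\<lambda>y. \<chi> \<alpha>. - ?c * ?M \<alpha> y) has_derivative (\<lambda>h. ?A *v h)) (at g)"
    unfolding has_derivative_componentwise_within[where f = "\<lambda>y. \<chi> \<alpha>. - ?c * ?M \<alpha> y"]
    by (auto simp: Basis_vec_def inner_axis)
qed

theorem theorem2p4:
  assumes "even CARD('d::finite)"
  shows "strictly_convex_on (finite_volume_forms :: ('n::finite, 'd) form set) vol \<and>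
    lower_semicontinuous_on (finite_volume_forms :: ('n, 'd) form set) vol \<and>
    (\<forall>g \<in> interior (finite_volume_forms :: ('n, 'd) form set).
      (\<forall>\<alpha> :: ('n, 'd) multi_index. integrable lborel (\<lambda>x. monomial (expo \<alpha>) x * exp (- eval_form g x))) \<and>
      GDERIV vol g :>
        (\<chi> \<alpha>. - 1 / Gamma (1 + real CARD('n) / real CARD('d)) *
          (LINT x|lborel. monomial (expo \<alpha>) x * exp (- eval_form g x))) \<and>
      (\<forall>(\<alpha> :: ('n, 'd) multi_index) (\<beta> :: ('n, 'd) multi_index). integrable lborel
        (\<lambda>x. monomial (\<lambda>i. expo \<alpha> i + expo \<beta> i) x * exp (- eval_form g x))) \<and>
      has_hessian vol
        (\<chi> \<alpha> \<beta>. 1 / Gamma (1 + real CARD('n) / real CARD('d)) *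
          (LINT x|lborel. monomial (\<lambda>i. expo \<alpha> i + expo \<beta> i) x * exp (- eval_form g x))) g) \<and>
    (\<forall>g \<in> (finite_volume_forms :: ('n, 'd) form set).
      integrable lborel (\<lambda>x. eval_form g x * exp (- eval_form g x)) \<and>
      integrable lborel (\<lambda>x. exp (- eval_form g x)) \<and>
      (LINT x|lborel. eval_form g x * exp (- eval_form g x)) =
        real CARD('n) / real CARD('d) * (LINT x|lborel. exp (- eval_form g x)))"
proof (intro conjI ballI allI)
  fix g :: "('n, 'd) form" assume g: "g \<in> interior finite_volume_forms"
  obtain \<epsilon> where \<epsilon>: "0 < \<epsilon>" "\<And>x. \<epsilon> * eval_form (power_form :: ('n, 'd) form) x \<le> eval_form g x"
    using interior_imp_coercive[OF g] by blast
  show "integrable lborel (\<lambda>x. monomial (expo \<alpha>) x * exp (- eval_form g x))" for \<alpha> :: "('n, 'd) multi_index"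
    using assms \<epsilon> by (rule integrable_moment[where C = 1 and k = 1])
      (simp_all add: abs_monomial_le_power_form assms)
  show "integrable lborel (\<lambda>x. monomial (\<lambda>i. expo \<alpha> i + expo \<beta> i) x * exp (- eval_form g x))"
    for \<alpha> \<beta> :: "('n, 'd) multi_index"
    using assms \<epsilon>
  proof (rule integrable_moment[where C = 1 and k = 2])
    show "\<bar>monomial (\<lambda>i. expo \<alpha> i + expo \<beta> i) x\<bar> \<le> 1 * eval_form (power_form :: ('n, 'd) form) x ^ 2" for x
      unfolding monomial_add abs_mult power2_eq_square
      using assms by (simp add: mult_mono abs_monomial_le_power_form eval_power_form_nonneg)
  qed simp
qed (use assms strictly_convex_vol lower_semicontinuous_vol vol_gderiv vol_has_hessian
    integrable_exp integrable_form_exp integral_form_exp in simp_all)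

end
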